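(* Let $D$ be a positive integer with $D \notin \{2^{3k}(2j+1) : k, j \in \mathbb{Z}_{\ge 0}\}$. Then, for integers $x$: (1) If $D = 2(2j+1)$ with $j \in \mathbb{Z}_{\geq 0}$, then $\nu_2(x^3 + D) = 1$ if $x \equiv 0 \pmod 2$, and $\nu_2(x^3+D) = 0$ if $x \equiv 1 \pmod 2$. (2) If $D = 2^2(2j+1)$ with $j \in \mathbb{Z}_{\geq 0}$, then $\nu_2(x^3 + D) = 2$ if $x \equiv 0 \pmod 2$, and $\nu_2(x^3+D) = 0$ if $x \equiv 1 \pmod 2$. (3) If $D = 2^{3k+i}$ with $k > 0$ an integer and $i \in \{1, 2\}$, then $$\nu_2(x^3 + D) = \begin{cases} 0 & \text{if } x \text{ is odd},\\ 3 & \text{if } x \equiv 2 \pmod 4,\\ 3\ell & \text{if } x \equiv 2^\ell \pmod{2^{\ell+1}},\ \ell = 2, \dots, k,\\ 3k+i & \text{if } x \equiv 0 \pmod{2^{k+1}}. \end{cases}$$ Hence, the $2$-adic valuation tree of $x^3 + D$ is finite.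
   Context: $\nu_2(n)$ denotes the $2$-adic valuation of the integer $n$: $\nu_2(n)=r$ where $n = 2^r b$ with $2\nmid b$ (and $\nu_2(0)=+\infty$). The $2$-adic valuation tree of $f(x) = x^3 + D$ is the rooted binary tree whose nodes at level $\ell \ge 0$ correspond to residue classes modulo $2^\ell$, defined as follows. The root (level $0$) is the class of all integers $x$. A node corresponding to a class $r \bmod 2^\ell$ is terminating (has no children) if $\nu_2(f(x))$ takes the same value for all integers $x \equiv r \pmod{2^\ell}$; otherwise it is non-terminating and has exactly two children at level $\ell+1$, the classes $r \bmod 2^{\ell+1}$ and $r + 2^\ell \bmod 2^{\ell+1}$. The tree is infinite if it has infinitely many nodes (equivalently, nodes at every level), and finite otherwise. *)

theory Defs
  imports "HOL-Number_Theory.Number_Theory" "HOL-Library.Extended_Nat"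
begin

(* The library's multiplicity p 0 is 0, hence the separate case. *)
definition nu2 :: "int \<Rightarrow> enat" where
  "nu2 n = (if n = 0 then \<infinity> else enat (multiplicity 2 n))"

(* The pair (l, r), with 0 <= r < 2 ^ l, stands for the residue class of r modulo 2 ^ l,
   a potential node at level l. *)
type_synonym node = "nat \<times> int"

definition node_class :: "node \<Rightarrow> int set" where
  "node_class v = {x. [x = snd v] (mod 2 ^ fst v)}"

definition terminating :: "(int \<Rightarrow> int) \<Rightarrow> node \<Rightarrow> bool" where
  "terminating f v \<longleftrightarrow> (\<exists>c. \<forall>x \<in> node_class v. nu2 (f x) = c)"

definition children :: "(int \<Rightarrow> int) \<Rightarrow> node \<Rightarrow> node set" where
  "children f v =
     (if terminating f v then {}
      else {(Suc (fst v), snd v), (Suc (fst v), snd v + 2 ^ fst v)})"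

inductive_set valuation_tree :: "(int \<Rightarrow> int) \<Rightarrow> node set" for f where
  root: "(0, 0) \<in> valuation_tree f"
| child: "v \<in> valuation_tree f \<Longrightarrow> w \<in> children f v \<Longrightarrow> w \<in> valuation_tree f"

end

theory Submission
  imports Defs
begin

text \<open>
  Everything follows from the ultrametric property of the 2-adic valuation: two summands of
  different valuations have a sum whose valuation is the smaller of the two. Write
  \<open>D = 2 ^ n * u\<close> with \<open>u\<close> odd; the assumption on \<open>D\<close> says that \<open>3\<close> does not divide \<open>n\<close>.
  A cube has a valuation divisible by \<open>3\<close>, so the valuations \<open>3 * l\<close> of \<open>x ^ 3\<close> and \<open>n\<close> of \<open>D\<close>
  never coincide, and the valuation of \<open>x ^ 3 + D\<close> is \<open>3 * l\<close> if \<open>3 * l < n\<close>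
  (\<open>nu2_cube_add_small\<close>) and \<open>n\<close> if \<open>3 * l > n\<close> (\<open>nu2_cube_add_large\<close>). The three explicit
  descriptions are instances of these two cases.

  For the finiteness of the tree, consider a class modulo \<open>2 ^ L\<close> with \<open>3 * L > n\<close>. Either all
  its members have the same valuation \<open>l < L\<close>, which then determines the valuation of
  \<open>x ^ 3 + D\<close>, or all its members are divisible by \<open>2 ^ L\<close>, and then the valuation of
  \<open>x ^ 3 + D\<close> is \<open>n\<close>. So every class at level \<open>L\<close> terminates (\<open>terminating_cube_add\<close>), and a
  tree whose nodes all terminate at some level is finite
  (\<open>finite_valuation_tree_if_level_terminates\<close>).
\<close>

section \<open>Valuations of sums\<close>

lemma nu2_power_times_odd:
  assumes "odd u"
  shows "nu2 (2 ^ m * u) = enat m"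
proof -
  have "u \<noteq> 0" using assms by auto
  moreover have "multiplicity 2 (2 ^ m * u) = m"
    using assms by (intro multiplicity_eqI) auto
  ultimately show ?thesis by (simp add: nu2_def)
qed

lemma nu2_power_times_odd_add:
  assumes "odd u" and "2 ^ Suc m dvd b"
  shows "nu2 (2 ^ m * u + b) = enat m"
proof -
  obtain c where "b = 2 ^ Suc m * c" using assms(2) by (elim dvdE)
  then have "2 ^ m * u + b = 2 ^ m * (u + 2 * c)" by (simp add: algebra_simps)
  moreover have "odd (u + 2 * c)" using assms(1) by simp
  ultimately show ?thesis using nu2_power_times_odd by metis
qed

lemma nu2_cube_add_small:
  fixes u y :: int
  assumes "odd y" and "3 * l < n"
  shows "nu2 ((2 ^ l * y) ^ 3 + 2 ^ n * u) = enat (3 * l)"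
proof -
  have "(2 ^ l * y) ^ 3 = 2 ^ (3 * l) * y ^ 3"
    by (simp add: power_mult_distrib power_mult[symmetric] mult.commute)
  moreover have "(2::int) ^ Suc (3 * l) dvd 2 ^ n * u"
    using assms(2) by (intro dvd_mult2 le_imp_power_dvd) simp
  ultimately show ?thesis using assms(1) nu2_power_times_odd_add by simp
qed

lemma nu2_cube_add_large:
  fixes u x :: int
  assumes "odd u" and "2 ^ l dvd x" and "n < 3 * l"
  shows "nu2 (x ^ 3 + 2 ^ n * u) = enat n"
proof -
  have "(2 ^ l) ^ 3 dvd x ^ 3" using assms(2) by (rule dvd_power_same)
  moreover have "(2::int) ^ Suc n dvd (2 ^ l) ^ 3"
    using assms(3) by (simp only: power_mult[symmetric]) (rule le_imp_power_dvd, simp)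
  ultimately have "2 ^ Suc n dvd x ^ 3" by (rule dvd_trans[rotated])
  then show ?thesis using assms(1) nu2_power_times_odd_add by (metis add.commute)
qed

section \<open>Finiteness of the valuation tree\<close>

text \<open>
  No node lies below a level all of whose classes terminate, and each level consists of finitely
  many residues.
\<close>

lemma finite_valuation_tree_if_level_terminates:
  assumes "\<And>r. 0 \<le> r \<Longrightarrow> r < 2 ^ N \<Longrightarrow> terminating f (N, r)"
  shows "finite (valuation_tree f)"
proof (rule finite_subset)
  show "valuation_tree f \<subseteq> Sigma {..N} (\<lambda>l. {0..<2 ^ l})"
  proof
    fix v assume "v \<in> valuation_tree f"
    then show "v \<in> Sigma {..N} (\<lambda>l. {0..<2 ^ l})"
    proof induction
      case root
      show ?case by simp
    next
      case (child v w)
      obtain l r where v: "v = (l, r)" by (cases v)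
      have r: "l \<le> N" "0 \<le> r" "r < 2 ^ l" using child.IH v by auto
      have "\<not> terminating f (l, r)"
        and w: "w = (Suc l, r) \<or> w = (Suc l, r + 2 ^ l)"
        using child.hyps(2) v by (auto simp: children_def split: if_splits)
      then have "l \<noteq> N" using assms r by auto
      then show ?case using r w by auto
    qed
  qed
qed simp

lemma terminating_cube_add:
  fixes u :: int
  assumes "odd u" and "\<not> 3 dvd n" and "n < 3 * L"
  shows "terminating (\<lambda>x. x ^ 3 + 2 ^ n * u) (L, r)"
proof (cases "2 ^ L dvd r")
  case True
  have "nu2 (x ^ 3 + 2 ^ n * u) = enat n" if "x \<in> node_class (L, r)" for x
  proof -
    have "2 ^ L dvd x" using that True by (simp add: node_class_def cong_dvd_iff)
    then show ?thesis using nu2_cube_add_large assms by blast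
  qed
  then show ?thesis unfolding terminating_def by blast
next
  case False
  then have "r \<noteq> 0" by auto
  then obtain y where y: "r = 2 ^ multiplicity 2 r * y" "odd y"
    by (rule multiplicity_decompose'[of r 2]) auto
  define l where "l = multiplicity 2 r"
  have r: "r = 2 ^ l * y" using y l_def by simp
  have "l < L"
    using False r by (metis dvd_mult2 le_imp_power_dvd not_le)
  then have dvd: "(2::int) ^ Suc l dvd 2 ^ L" by (intro le_imp_power_dvd) simp
  \<comment> \<open>The members of the class differ by multiples of a higher power of two than the one in \<open>r\<close>,
     so all of them contain the same power of two as \<open>r\<close>.\<close>
  have x: "\<exists>z. odd z \<and> x = 2 ^ l * z" if "x \<in> node_class (L, r)" for x
  proof -
    have "2 ^ L dvd x - r" using that by (simp add: node_class_def cong_iff_dvd_diff)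
    then have "2 ^ Suc l dvd x - r" using dvd by (rule dvd_trans[rotated])
    then obtain c where "x - r = 2 ^ Suc l * c" by (elim dvdE)
    then have "x = 2 ^ l * (y + 2 * c)" using r by (simp add: algebra_simps)
    then show ?thesis using y(2) by (intro exI[of _ "y + 2 * c"]) simp
  qed
  have "3 * l \<noteq> n" using assms(2) by auto
  then consider "3 * l < n" | "n < 3 * l" by linarith
  then show ?thesis
  proof cases
    case 1
    have "nu2 (x ^ 3 + 2 ^ n * u) = enat (3 * l)" if "x \<in> node_class (L, r)" for x
      using x[OF that] nu2_cube_add_small 1 by blast
    then show ?thesis unfolding terminating_def by blast
  next
    case 2
    have "nu2 (x ^ 3 + 2 ^ n * u) = enat n" if "x \<in> node_class (L, r)" for x
      using x[OF that] nu2_cube_add_large[OF assms(1) _ 2] by fastforce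
    then show ?thesis unfolding terminating_def by blast
  qed
qed

lemma finite_valuation_tree_cube_add:
  fixes u :: int
  assumes "odd u" and "\<not> 3 dvd n"
  shows "finite (valuation_tree (\<lambda>x. x ^ 3 + 2 ^ n * u))"
proof (rule finite_valuation_tree_if_level_terminates)
  have "n < 3 * n" using assms(2) by (cases n) auto
  then show "terminating (\<lambda>x. x ^ 3 + 2 ^ n * u) (n, r)" for r
    using terminating_cube_add assms by blast
qed

section \<open>The valuations and the tree of \<open>x ^ 3 + D\<close>\<close>

lemma cong_power_two_decompose:
  fixes x :: int
  assumes "[x = 2 ^ l] (mod 2 ^ Suc l)"
  obtains y where "odd y" and "x = 2 ^ l * y"
proof -
  have "2 ^ Suc l dvd x - 2 ^ l" using assms by (simp only: cong_iff_dvd_diff)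
  then obtain c where "x - 2 ^ l = 2 ^ Suc l * c" by (elim dvdE)
  then have "x = 2 ^ l * (1 + 2 * c)" by (simp add: algebra_simps)
  then show thesis using that[of "1 + 2 * c"] by simp
qed

lemma odd_int_nonneg_obtain:
  fixes u :: int
  assumes "odd u" and "u > 0"
  obtains j :: nat where "u = 2 * int j + 1"
proof -
  obtain c where "u = 2 * c + 1" using assms(1) by (elim oddE)
  then show thesis using that[of "nat c"] assms(2) by simp
qed

theorem proposition4p2:
  fixes D :: int
  assumes "D > 0"
    and "D \<notin> {2 ^ (3 * k) * (2 * int j + 1) | k j :: nat. True}"
  shows "(\<forall>j::nat. D = 2 * (2 * int j + 1) \<longrightarrow>
            (\<forall>x::int. ([x = 0] (mod 2) \<longrightarrow> nu2 (x ^ 3 + D) = 1) \<and>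
                      ([x = 1] (mod 2) \<longrightarrow> nu2 (x ^ 3 + D) = 0)))
       \<and> (\<forall>j::nat. D = 2 ^ 2 * (2 * int j + 1) \<longrightarrow>
            (\<forall>x::int. ([x = 0] (mod 2) \<longrightarrow> nu2 (x ^ 3 + D) = 2) \<and>
                      ([x = 1] (mod 2) \<longrightarrow> nu2 (x ^ 3 + D) = 0)))
       \<and> (\<forall>k i :: nat. k > 0 \<and> i \<in> {1, 2} \<and> D = 2 ^ (3 * k + i) \<longrightarrow>
            (\<forall>x::int. (odd x \<longrightarrow> nu2 (x ^ 3 + D) = 0) \<and>
                      ([x = 2] (mod 4) \<longrightarrow> nu2 (x ^ 3 + D) = 3) \<and>
                      (\<forall>l \<in> {2..k}. [x = 2 ^ l] (mod 2 ^ (l + 1)) \<longrightarrow>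
                          nu2 (x ^ 3 + D) = enat (3 * l)) \<and>
                      ([x = 0] (mod 2 ^ (k + 1)) \<longrightarrow> nu2 (x ^ 3 + D) = enat (3 * k + i))))
       \<and> finite (valuation_tree (\<lambda>x. x ^ 3 + D))"
proof (intro conjI allI impI ballI)
  have odd_case: "nu2 (x ^ 3 + 2 ^ n * u) = 0" if "odd x" "0 < n" for x u :: int and n
    using nu2_cube_add_small[of x 0 n u] that by (simp add: zero_enat_def)
  have even_case: "nu2 (x ^ 3 + 2 ^ n * u) = enat n" if "even x" "odd u" "n < 3" for x u :: int and n
    using nu2_cube_add_large[of u 1 x n] that by simp
  {
    fix j :: nat and x :: int
    assume D: "D = 2 * (2 * int j + 1)"
    show "nu2 (x ^ 3 + D) = 1" if "[x = 0] (mod 2)"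
      using even_case[of x "2 * int j + 1" 1] that D by (simp add: cong_0_iff one_enat_def)
    show "nu2 (x ^ 3 + D) = 0" if "[x = 1] (mod 2)"
      using odd_case[of x 1 "2 * int j + 1"] that D by (simp add: cong_def odd_iff_mod_2_eq_one)
  next
    fix j :: nat and x :: int
    assume D: "D = 2 ^ 2 * (2 * int j + 1)"
    show "nu2 (x ^ 3 + D) = 2" if "[x = 0] (mod 2)"
      using even_case[of x "2 * int j + 1" 2] that D by (simp add: cong_0_iff numeral_eq_enat)
    show "nu2 (x ^ 3 + D) = 0" if "[x = 1] (mod 2)"
      using odd_case[of x 2 "2 * int j + 1"] that D by (simp add: cong_def odd_iff_mod_2_eq_one)
  next
    fix k i :: nat and x :: int
    assume "k > 0 \<and> i \<in> {1, 2} \<and> D = 2 ^ (3 * k + i)"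
    then have k: "k > 0" and i: "0 < i" "i < 3" and D: "D = 2 ^ (3 * k + i) * 1" by auto
    show "nu2 (x ^ 3 + D) = 0" if "odd x"
      unfolding D using that i by (intro odd_case) auto
    have eq: "nu2 (x ^ 3 + D) = enat (3 * l)" if cong: "[x = 2 ^ l] (mod 2 ^ Suc l)" and l: "l \<le> k" for l
    proof -
      obtain y where "odd y" "x = 2 ^ l * y" using cong by (rule cong_power_two_decompose)
      then show ?thesis unfolding D using nu2_cube_add_small[of y l "3 * k + i" 1] l i by simp
    qed
    show "nu2 (x ^ 3 + D) = 3" if "[x = 2] (mod 4)"
      using eq[of 1] that k by (simp add: numeral_eq_enat)
    show "nu2 (x ^ 3 + D) = enat (3 * l)"
      if "l \<in> {2..k}" "[x = 2 ^ l] (mod 2 ^ (l + 1))" for l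
      using eq[of l] that by simp
    show "nu2 (x ^ 3 + D) = enat (3 * k + i)" if "[x = 0] (mod 2 ^ (k + 1))"
      unfolding D using that i by (intro nu2_cube_add_large[of _ "k + 1"]) (auto simp: cong_0_iff)
  }
  show "finite (valuation_tree (\<lambda>x. x ^ 3 + D))"
  proof -
    have "D \<noteq> 0" using assms(1) by simp
    then obtain u where u: "D = 2 ^ multiplicity 2 D * u" "odd u"
      by (rule multiplicity_decompose'[of D 2]) auto
    define n where "n = multiplicity 2 D"
    have D: "D = 2 ^ n * u" using u(1) n_def by simp
    have "u > 0" using assms(1) D by (simp add: zero_less_mult_iff)
    then obtain j :: nat where "u = 2 * int j + 1" using u(2) odd_int_nonneg_obtain by blast
    then have "\<not> 3 dvd n" using assms(2) D by (auto elim!: dvdE)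
    then show ?thesis unfolding D using u(2) by (intro finite_valuation_tree_cube_add)
  qed
qed

end
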